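(* Let $N\ge 2$ and $m\ge 1$ be integers and let $x^{(r,s)}_k$ ($1\le r,s\le N$, $1\le k\le m$) be elements of a commutative ring; set $x^{(r,s)}_{m+1}=0$ for all $1\le r,s\le N$. Let $G'(N,m)$ be the $Nm\times Nm$ matrix which, as an $N\times N$ block matrix with $m\times m$ blocks, has $(r,s)$ block $$G'_{rs}=\begin{cases}A_m(x^{(r,s)}_1,\dots,x^{(r,s)}_m), & r,s \text{ odd},\\ D_m(x^{(r,s)}_1,\dots,x^{(r,s)}_m), & r \text{ odd},\ s \text{ even},\\ C_m(x^{(r,s)}_1,\dots,x^{(r,s)}_m), & r \text{ even},\ s \text{ odd},\\ B_m(x^{(r,s)}_1,\dots,x^{(r,s)}_m), & r,s \text{ even}.\end{cases}$$ Then $$\det(G'(N,m))=\prod_{i=1}^{m}\det(X_{(i,i+1)}).$$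
   Context: For elements $x_1,\dots,x_m$, the following are $m\times m$ matrices, given by their $(p,q)$ entries: $A_m(x_1,\dots,x_m)$ has entry $x_{m+1-\min(p,q)}$; $B_m(x_1,\dots,x_m)$ has entry $x_{\max(p,q)}$; $C_m(x_1,\dots,x_m)$ has entry $x_{\max(p,\,m+1-q)}$; $D_m(x_1,\dots,x_m)$ has entry $x_{\max(m+1-p,\,q)}$. For $1\le i\le m$, $X_{(i,i+1)}$ is the $N\times N$ matrix whose $(r,s)$ entry is $x^{(r,s)}_i-x^{(r,s)}_{i+1}$. *)

theory Defs
  imports Jordan_Normal_Form.Determinant
begin

text \<open>
  Matrices of Jordan_Normal_Form are indexed from 0, whereas here the families
  \<open>x k\<close> (\<open>1 \<le> k \<le> m\<close>) and \<open>x r s k\<close> (\<open>1 \<le> r, s \<le> N\<close>, \<open>1 \<le> k \<le> m + 1\<close>), block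
  positions and the row/column numbers \<open>p\<close>, \<open>q\<close> are all counted from 1.
  \<open>mat1\<close> builds a matrix from an entry function in the 1-based convention, so that the
  formulas below keep their usual form.
\<close>

definition mat1 :: "nat \<Rightarrow> nat \<Rightarrow> (nat \<Rightarrow> nat \<Rightarrow> 'a) \<Rightarrow> 'a mat" where
  "mat1 nr nc f = mat nr nc (\<lambda>(i, j). f (i + 1) (j + 1))"

definition A_block :: "nat \<Rightarrow> (nat \<Rightarrow> 'a) \<Rightarrow> 'a mat" where
  "A_block m x = mat1 m m (\<lambda>p q. x (m + 1 - min p q))"

definition B_block :: "nat \<Rightarrow> (nat \<Rightarrow> 'a) \<Rightarrow> 'a mat" where
  "B_block m x = mat1 m m (\<lambda>p q. x (max p q))"

definition C_block :: "nat \<Rightarrow> (nat \<Rightarrow> 'a) \<Rightarrow> 'a mat" where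
  "C_block m x = mat1 m m (\<lambda>p q. x (max p (m + 1 - q)))"

definition D_block :: "nat \<Rightarrow> (nat \<Rightarrow> 'a) \<Rightarrow> 'a mat" where
  "D_block m x = mat1 m m (\<lambda>p q. x (max (m + 1 - p) q))"

text \<open>
  The \<open>N \<times> N\<close> block matrix whose block in position \<open>(r, s)\<close>, counted from 1, is the
  \<open>m \<times> m\<close> matrix \<open>G r s\<close>. The 0-based row \<open>i\<close> of the whole matrix is the 0-based row
  \<open>i mod m\<close> of block row \<open>i div m + 1\<close>, and likewise for columns.
\<close>

definition block_matrix :: "nat \<Rightarrow> nat \<Rightarrow> (nat \<Rightarrow> nat \<Rightarrow> 'a mat) \<Rightarrow> 'a mat" where
  "block_matrix N m G =
     mat (N * m) (N * m) (\<lambda>(i, j). G (i div m + 1) (j div m + 1) $$ (i mod m, j mod m))"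

definition G'_block :: "nat \<Rightarrow> (nat \<Rightarrow> nat \<Rightarrow> nat \<Rightarrow> 'a) \<Rightarrow> nat \<Rightarrow> nat \<Rightarrow> 'a mat" where
  "G'_block m x r s =
     (if odd r \<and> odd s then A_block m (x r s)
      else if odd r \<and> even s then D_block m (x r s)
      else if even r \<and> odd s then C_block m (x r s)
      else B_block m (x r s))"

definition G' :: "nat \<Rightarrow> nat \<Rightarrow> (nat \<Rightarrow> nat \<Rightarrow> nat \<Rightarrow> 'a) \<Rightarrow> 'a mat" where
  "G' N m x = block_matrix N m (G'_block m x)"

definition X_diff :: "nat \<Rightarrow> (nat \<Rightarrow> nat \<Rightarrow> nat \<Rightarrow> 'a :: minus) \<Rightarrow> nat \<Rightarrow> 'a mat" where
  "X_diff N x i = mat1 N N (\<lambda>r s. x r s i - x r s (i + 1))"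

end

theory Submission
  imports Defs
begin

text \<open>
  Reversing the rows and columns inside every block with odd index turns all four shapes of
  block into \<open>B_block\<close>. Regrouping the indices so that the position inside a block becomes the
  outer one, we get the \<open>m \<times> m\<close> block matrix with \<open>(p, q)\<close> block \<open>X\<^bsub>max p q\<^esub>\<close>, where \<open>X\<^sub>k\<close> is
  the \<open>N \<times> N\<close> matrix of the \<open>x\<^sub>k\<close>. Both steps permute rows and columns simultaneously, so the
  determinant is unchanged. As \<open>X\<^bsub>max p q\<^esub>\<close> is the sum of the differences
  \<open>X\<^sub>k - X\<^bsub>k+1\<^esub>\<close> over \<open>k \<ge> max p q\<close>, the matrix is \<open>U D U\<^sup>T\<close> with \<open>U\<close> unitriangular and \<open>D\<close> the
  block diagonal matrix of these differences.
\<close>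

section \<open>Permutation invariance and block diagonal determinants over commutative rings\<close>

text \<open>Transposition lets the row rule act on the columns as well, so the sign of
  \<open>p\<close> occurs twice and squares to 1.\<close>

lemma det_permute_rows_cols:
  fixes A :: "'a :: comm_ring_1 mat"
  assumes A: "A \<in> carrier_mat n n" and p: "p permutes {0..<n}"
  shows "det (mat n n (\<lambda>(i, j). A $$ (p i, p j))) = det A"
proof -
  have p_less: "p i < n" if "i < n" for i
    using permutes_in_image[OF p, of i] that by simp
  define B where "B = mat n n (\<lambda>(i, j). A $$ (p i, j))"
  have B: "B \<in> carrier_mat n n" by (simp add: B_def)
  have "det (mat n n (\<lambda>(i, j). A $$ (p i, p j))) =
      det (mat n n (\<lambda>(i, j). A $$ (p i, p j)))\<^sup>T"
    by (rule det_transpose[symmetric, of _ n]) simp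
  also have "(mat n n (\<lambda>(i, j). A $$ (p i, p j)))\<^sup>T = mat n n (\<lambda>(i, j). B\<^sup>T $$ (p i, j))"
    by (rule eq_matI) (auto simp: B_def p_less)
  also have "det \<dots> = signof p * det B\<^sup>T"
    using B by (intro det_permute_rows p) simp
  also have "det B\<^sup>T = signof p * det A"
    using det_transpose[OF B] det_permute_rows[OF A p] by (simp add: B_def)
  also have "signof p * (signof p * det A) = det A"
    by (simp add: sign_def)
  finally show ?thesis .
qed

text \<open>Induction on \<open>k\<close>: the last diagonal 1 is split off as a corner of size 1
  with zeros above and to its left.\<close>

lemma det_four_block_mat_one_lower_right:
  fixes A :: "'a :: comm_ring_1 mat"
  assumes A: "A \<in> carrier_mat n n"
  shows "det (four_block_mat A (0\<^sub>m n k) (0\<^sub>m k n) (1\<^sub>m k)) = det A"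
proof (induction k)
  case 0
  have "four_block_mat A (0\<^sub>m n 0) (0\<^sub>m 0 n) (1\<^sub>m 0) = A"
    using A by (intro eq_matI) auto
  then show ?case by simp
next
  case (Suc k)
  define F where "F = four_block_mat A (0\<^sub>m n k) (0\<^sub>m k n) (1\<^sub>m k)"
  have F: "F \<in> carrier_mat (n + k) (n + k)" using A by (simp add: F_def)
  have "four_block_mat A (0\<^sub>m n (Suc k)) (0\<^sub>m (Suc k) n) (1\<^sub>m (Suc k)) =
      four_block_mat F (0\<^sub>m (n + k) 1) (0\<^sub>m 1 (n + k)) (1\<^sub>m 1)"
    using A by (intro eq_matI) (auto simp: F_def)
  moreover have "det (four_block_mat F (0\<^sub>m (n + k) 1) (0\<^sub>m 1 (n + k)) (1\<^sub>m 1)) = det F * det (1\<^sub>m 1 :: 'a mat)"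
    by (rule det_four_block_mat_upper_right_zero_col[OF F]) auto
  ultimately show ?case using Suc by (simp add: F_def)
qed

lemma det_four_block_mat_one_upper_left:
  fixes D :: "'a :: comm_ring_1 mat"
  assumes D: "D \<in> carrier_mat k k"
  shows "det (four_block_mat (1\<^sub>m n) (0\<^sub>m n k) (0\<^sub>m k n) D) = det D"
proof (induction n)
  case 0
  have "four_block_mat (1\<^sub>m 0) (0\<^sub>m 0 k) (0\<^sub>m k 0) D = D"
    using D by (intro eq_matI) auto
  then show ?case by simp
next
  case (Suc n)
  define F where "F = four_block_mat (1\<^sub>m n) (0\<^sub>m n k) (0\<^sub>m k n) D"
  have F: "F \<in> carrier_mat (n + k) (n + k)" using D by (simp add: F_def)
  have "four_block_mat (1\<^sub>m (Suc n)) (0\<^sub>m (Suc n) k) (0\<^sub>m k (Suc n)) D =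
      four_block_mat (1\<^sub>m 1) (0\<^sub>m 1 (n + k)) (0\<^sub>m (n + k) 1) F"
    using D by (intro eq_matI) (auto simp: F_def)
  moreover have "det (four_block_mat (1\<^sub>m 1) (0\<^sub>m 1 (n + k)) (0\<^sub>m (n + k) 1) F) = det (1\<^sub>m 1 :: 'a mat) * det F"
    by (rule det_four_block_mat_lower_left_zero_col) (use F in auto)
  ultimately show ?case using Suc by (simp add: F_def)
qed

text \<open>The library has this only over integral domains.\<close>

lemma det_four_block_mat_diag:
  fixes A D :: "'a :: comm_ring_1 mat"
  assumes A: "A \<in> carrier_mat n n" and D: "D \<in> carrier_mat k k"
  shows "det (four_block_mat A (0\<^sub>m n k) (0\<^sub>m k n) D) = det A * det D"
proof -
  let ?P = "four_block_mat A (0\<^sub>m n k) (0\<^sub>m k n) (1\<^sub>m k)"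
  let ?Q = "four_block_mat (1\<^sub>m n) (0\<^sub>m n k) (0\<^sub>m k n) D"
  \<comment> \<open>diag(A, D) = diag(A, 1) diag(1, D), so multiplicativity of \<open>det\<close>
    suffices and nothing has to be cancelled or inverted.\<close>
  have "four_block_mat A (0\<^sub>m n k) (0\<^sub>m k n) D = ?P * ?Q"
    using A D by (subst mult_four_block_mat[of _ n n _ k _ k _ _ n _ k]) auto
  also have "det \<dots> = det ?P * det ?Q"
    using A D by (intro det_mult[of _ "n + k"]) simp_all
  finally show ?thesis
    using A D by (simp add: det_four_block_mat_one_lower_right det_four_block_mat_one_upper_left)
qed

lemma det_block_diagonal:
  fixes Y :: "nat \<Rightarrow> nat \<Rightarrow> nat \<Rightarrow> 'a :: comm_ring_1"
  assumes N: "N > 0"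
  shows "det (mat (m * N) (m * N) (\<lambda>(i, j).
           if i div N = j div N then Y (i div N) (i mod N) (j mod N) else 0)) =
         (\<Prod>k<m. det (mat N N (\<lambda>(i, j). Y k i j)))"
proof (induction m)
  case 0
  show ?case by simp
next
  case (Suc m)
  let ?D = "\<lambda>m. mat (m * N) (m * N) (\<lambda>(i, j).
           if i div N = j div N then Y (i div N) (i mod N) (j mod N) else 0)"
  let ?Y = "mat N N (\<lambda>(i, j). Y m i j)"
  have high: "i div N = m \<and> i mod N = i - m * N" if "\<not> i < m * N" "i < N + m * N" for i
  proof -
    from that have "i = (i - m * N) + m * N" and less: "i - m * N < N" by auto
    then have "i div N = ((i - m * N) + m * N) div N" "i mod N = ((i - m * N) + m * N) mod N"
      by simp_all
    with less N show ?thesis by simp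
  qed
  have low: "i div N < m" if "i < m * N" for i
    using that by (simp add: less_mult_imp_div_less)
  have "?D (Suc m) = four_block_mat (?D m) (0\<^sub>m (m * N) N) (0\<^sub>m N (m * N)) ?Y"
  proof (rule eq_matI)
    fix i j
    assume "i < dim_row (four_block_mat (?D m) (0\<^sub>m (m * N) N) (0\<^sub>m N (m * N)) ?Y)"
      and "j < dim_col (four_block_mat (?D m) (0\<^sub>m (m * N) N) (0\<^sub>m N (m * N)) ?Y)"
    then have ij: "i < N + m * N" "j < N + m * N" by simp_all
    show "?D (Suc m) $$ (i, j) =
        four_block_mat (?D m) (0\<^sub>m (m * N) N) (0\<^sub>m N (m * N)) ?Y $$ (i, j)"
      using ij high[of i] high[of j] low[of i] low[of j]
      by (cases "i < m * N"; cases "j < m * N") simp_all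
  qed simp_all
  then have "det (?D (Suc m)) = det (?D m) * det ?Y"
    using det_four_block_mat_diag[of "?D m" "m * N" ?Y N] by simp
  then show ?case
    using Suc by simp
qed

section \<open>Block matrices whose blocks depend on the maximum of the positions\<close>

lemma div_mod_mult_add:
  fixes p r N :: nat
  assumes "r < N"
  shows "(p * N + r) div N = p" "(p * N + r) mod N = r"
  using assms by simp_all

lemma mult_add_less_mult:
  fixes p r m N :: nat
  assumes "p < m" "r < N"
  shows "p * N + r < m * N"
proof -
  have "p * N + r < Suc p * N" using assms by simp
  also have "\<dots> \<le> m * N" using assms by (intro mult_le_mono1) simp
  finally show ?thesis .
qed

text \<open>The indices below \<open>m * N\<close> in the class of \<open>r\<close> are the
  \<open>p * N + r\<close> with \<open>p < m\<close>. This evaluates products with the matrix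
  \<open>U\<close> below, whose nonzero entries join indices of equal residue.\<close>

lemma sum_residue_class:
  fixes f :: "nat \<Rightarrow> 'a :: comm_monoid_add"
  assumes r: "r < N"
  shows "(\<Sum>k = 0..<m * N. if k mod N = r then f (k div N) else 0) = (\<Sum>p = 0..<m. f p)"
proof -
  have "(\<Sum>k = 0..<m * N. if k mod N = r then f (k div N) else 0) =
      (\<Sum>k | k < m * N \<and> k mod N = r. f (k div N))"
    by (subst sum.inter_filter[symmetric]) auto
  also have "\<dots> = (\<Sum>p = 0..<m. f p)"
    using r mult_add_less_mult[of _ m r N]
    by (intro sum.reindex_bij_witness[of _ "\<lambda>p. p * N + r" "\<lambda>k. k div N"])
      (auto simp: div_mod_mult_add less_mult_imp_div_less)
  finally show ?thesis .
qed

lemma det_max_block_matrix: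
  fixes z :: "nat \<Rightarrow> nat \<Rightarrow> nat \<Rightarrow> 'a :: comm_ring_1"
  assumes N: "N > 0" and z: "\<And>r s. r < N \<Longrightarrow> s < N \<Longrightarrow> z m r s = 0"
  shows "det (mat (m * N) (m * N) (\<lambda>(i, j). z (max (i div N) (j div N)) (i mod N) (j mod N))) =
    (\<Prod>k<m. det (mat N N (\<lambda>(r, s). z k r s - z (Suc k) r s)))"
    (is "det ?H = _")
proof -
  define n where "n = m * N"
  define Y where "Y k r s = z k r s - z (Suc k) r s" for k r s
  \<comment> \<open>The \<open>m\<close> by \<open>m\<close> upper triangular all-ones matrix with
    each 1 replaced by the \<open>N\<close> by \<open>N\<close> identity.\<close>
  define U :: "'a mat" where
    "U = mat n n (\<lambda>(i, j). if j mod N = i mod N \<and> i div N \<le> j div N then 1 else 0)"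
  define D where
    "D = mat n n (\<lambda>(i, j). if i div N = j div N then Y (i div N) (i mod N) (j mod N) else 0)"
  have U: "U \<in> carrier_mat n n" and D: "D \<in> carrier_mat n n"
    by (simp_all add: U_def D_def)
  have div_less: "i div N < m" if "i < n" for i
    using that by (simp add: less_mult_imp_div_less n_def)
  define E where "E = D * U\<^sup>T"
  have E: "E \<in> carrier_mat n n"
    using U D by (simp add: E_def)
  have E_index: "E $$ (i, j) =
      (if j div N \<le> i div N then Y (i div N) (i mod N) (j mod N) else 0)"
    if i: "i < n" and j: "j < n" for i j
  proof -
    \<comment> \<open>The outer condition comes from \<open>U\<^sup>T\<close>, the inner one from
      \<open>D\<close>; together they fix \<open>l\<close> by its residue and quotient.\<close>
    have "E $$ (i, j) = (\<Sum>l = 0..<m * N. if l mod N = j mod N then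
        (if l div N = i div N then
          (if j div N \<le> i div N then Y (i div N) (i mod N) (j mod N) else 0) else 0) else 0)"
      using i j by (auto simp: E_def D_def U_def scalar_prod_def n_def intro!: sum.cong)
    also have "\<dots> = (\<Sum>p = 0..<m. if p = i div N then
        (if j div N \<le> i div N then Y (i div N) (i mod N) (j mod N) else 0) else 0)"
      using N by (intro sum_residue_class) simp
    also have "\<dots> = (if j div N \<le> i div N then Y (i div N) (i mod N) (j mod N) else 0)"
      using div_less[OF i] by simp
    finally show ?thesis .
  qed
  have telescope: "(\<Sum>p = a..<m. Y p r s) = z a r s" if "a \<le> m" "r < N" "s < N" for a r s
    \<comment> \<open>The sign is reversed because the rule sums successor minus predecessor; the
      boundary term \<open>z m r s\<close> vanishes by assumption.\<close>
    using sum_Suc_diff'[of a m "\<lambda>p. - z p r s"] that z[of r s] by (simp add: Y_def)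
  have "?H = U * E"
  proof (rule eq_matI)
    fix i j assume "i < dim_row (U * E)" "j < dim_col (U * E)"
    then have i: "i < n" and j: "j < n" using U E by simp_all
    let ?a = "max (i div N) (j div N)"
    have "(U * E) $$ (i, j) = (\<Sum>k = 0..<n. U $$ (i, k) * E $$ (k, j))"
      using i j U E by (auto simp: scalar_prod_def intro!: sum.cong)
    \<comment> \<open>\<open>U\<close> demands \<open>i div N \<le> k div N\<close> and
      \<open>E\<close> demands \<open>j div N \<le> k div N\<close>, which is where the maximum
      comes from.\<close>
    also have "\<dots> = (\<Sum>k = 0..<m * N. if k mod N = i mod N then
        (if ?a \<le> k div N then Y (k div N) (i mod N) (j mod N) else 0) else 0)"
      using i j by (auto simp: E_index U_def n_def intro!: sum.cong)
    also have "\<dots> = (\<Sum>p = 0..<m. if ?a \<le> p then Y p (i mod N) (j mod N) else 0)"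
      using N by (intro sum_residue_class) simp
    also have "\<dots> = (\<Sum>p = ?a..<m. Y p (i mod N) (j mod N))"
      by (intro sum.mono_neutral_cong_right) auto
    also have "\<dots> = z ?a (i mod N) (j mod N)"
      using N div_less[OF i] div_less[OF j] by (intro telescope) auto
    finally show "?H $$ (i, j) = (U * E) $$ (i, j)"
      using i j by (simp add: n_def)
  qed (use U E in \<open>auto simp: n_def\<close>)
  moreover have "det (U * E) = det U * (det D * det U\<^sup>T)"
    using U D by (simp add: E_def det_mult[of _ n])
  moreover have "det U = 1"
  proof -
    have "upper_triangular U"
    proof (rule upper_triangularI)
      fix i j assume ji: "j < i" and "i < dim_row U"
      then have "i < n" by (simp add: U_def)
      moreover have "\<not> (j mod N = i mod N \<and> i div N \<le> j div N)"
      proof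
        assume "j mod N = i mod N \<and> i div N \<le> j div N"
        moreover have "j div N \<le> i div N" using ji by (intro div_le_mono) simp
        ultimately have "j = i" by (metis div_mult_mod_eq le_antisym)
        with ji show False by simp
      qed
      ultimately show "U $$ (i, j) = 0" using ji by (simp add: U_def)
    qed
    then have "det U = prod_list (diag_mat U)" by (rule det_upper_triangular[OF _ U])
    also have "\<dots> = 1" by (simp add: prod_list_diag_prod U_def)
    finally show ?thesis .
  qed
  ultimately show ?thesis
    using det_transpose[OF U] det_block_diagonal[OF N, of m Y] by (simp add: D_def n_def Y_def)
qed

text \<open>The 0-based block row \<open>r\<close> has the 1-based index \<open>r + 1\<close>, so it is reversed when \<open>r\<close> is even.\<close>

definition flip :: "nat \<Rightarrow> nat \<Rightarrow> nat \<Rightarrow> nat" where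
  "flip m r p = (if even r then m - 1 - p else p)"

lemma flip_less: "p < m \<Longrightarrow> flip m r p < m"
  by (auto simp: flip_def)

lemma flip_flip: "p < m \<Longrightarrow> flip m r (flip m r p) = p"
  by (auto simp: flip_def)

text \<open>The new index \<open>p * N + r\<close> is sent to the old index
  \<open>r * m + flip m r p\<close>. Outside the range it is the identity, as
  \<open>permutes\<close> requires.\<close>

definition regroup :: "nat \<Rightarrow> nat \<Rightarrow> nat \<Rightarrow> nat" where
  "regroup N m i = (if i < N * m then (i mod N) * m + flip m (i mod N) (i div N) else i)"

lemma regroup_div_mod:
  assumes "i < N * m"
  shows "regroup N m i div m = i mod N" "regroup N m i mod m = flip m (i mod N) (i div N)"
proof -
  have "i div N < m" using assms by (simp add: less_mult_imp_div_less mult.commute)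
  then have "flip m (i mod N) (i div N) < m" by (rule flip_less)
  then show "regroup N m i div m = i mod N" "regroup N m i mod m = flip m (i mod N) (i div N)"
    using assms by (simp_all add: regroup_def)
qed

lemma regroup_less:
  assumes "i < N * m"
  shows "regroup N m i < N * m"
proof -
  have "N > 0" using assms by (cases N) auto
  moreover have "i div N < m" using assms by (simp add: less_mult_imp_div_less mult.commute)
  ultimately show ?thesis
    using assms by (simp add: regroup_def mult_add_less_mult flip_less)
qed

lemma regroup_permutes: "regroup N m permutes {0..<N * m}"
proof (rule inj_imp_permutes)
  show "inj_on (regroup N m) {0..<N * m}"
  proof (rule inj_onI)
    fix i j assume ij: "i \<in> {0..<N * m}" "j \<in> {0..<N * m}" and eq: "regroup N m i = regroup N m j"
    then have less: "i div N < m" "j div N < m"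
      by (simp_all add: less_mult_imp_div_less mult.commute)
    \<comment> \<open>The quotient by \<open>m\<close> returns the block number; the remainder then
      returns the position, since \<open>flip\<close> is an involution.\<close>
    from ij eq have "i mod N = j mod N" by (metis atLeastLessThan_iff regroup_div_mod(1))
    moreover from this ij eq have "flip m (i mod N) (i div N) = flip m (i mod N) (j div N)"
      by (metis atLeastLessThan_iff regroup_div_mod(2))
    then have "i div N = j div N" using less by (metis flip_flip)
    ultimately show "i = j" by (metis div_mult_mod_eq)
  qed
next
  show "regroup N m i \<in> {0..<N * m}" if "i \<in> {0..<N * m}" for i
    using that regroup_less by simp
  show "regroup N m i = i" if "i \<notin> {0..<N * m}" for i
    using that by (simp add: regroup_def)
qed simp

text \<open>Here the four shapes become one: each of \<open>A_block\<close>, \<open>C_block\<close>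
  and \<open>D_block\<close> is \<open>B_block\<close> with rows, columns or both reversed,
  according to the parities of \<open>r\<close> and \<open>s\<close>.\<close>

lemma G'_block_index:
  assumes "p < m" "q < m"
  shows "G'_block m x (r + 1) (s + 1) $$ (p, q) =
    x (r + 1) (s + 1) (max (flip m r p) (flip m s q) + 1)"
proof -
  \<comment> \<open>Reversal turns a minimum into a maximum; this is the case of
    \<open>A_block\<close>, where both indices are reversed.\<close>
  have "m + 1 - min (p + 1) (q + 1) = max (m - 1 - p) (m - 1 - q) + 1"
    using assms
    by (cases "p \<le> q") (simp_all add: min_absorb1 min_absorb2 max_absorb1 max_absorb2 diff_le_mono2)
  moreover have "m + 1 - (p + 1) = m - 1 - p + 1" "m + 1 - (q + 1) = m - 1 - q + 1"
    using assms by simp_all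
  ultimately show ?thesis
    using assms
    by (cases "even r"; cases "even s")
      (simp_all add: G'_block_def flip_def A_block_def B_block_def C_block_def D_block_def mat1_def)
qed

lemma G'_block_flip:
  assumes "p < m" "q < m"
  shows "G'_block m x (r + 1) (s + 1) $$ (flip m r p, flip m s q) = x (r + 1) (s + 1) (max p q + 1)"
  using assms by (simp only: G'_block_index flip_less flip_flip)

theorem theorem4p2:
  fixes N m :: nat and x :: "nat \<Rightarrow> nat \<Rightarrow> nat \<Rightarrow> 'a :: comm_ring_1"
  assumes "N \<ge> 2" and "m \<ge> 1"
    and "\<And>r s. r \<in> {1..N} \<Longrightarrow> s \<in> {1..N} \<Longrightarrow> x r s (m + 1) = 0"
  shows "det (G' N m x) = (\<Prod>i = 1..m. det (X_diff N x i))"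
proof -
  \<comment> \<open>All indices are shifted to start at 0, so \<open>z m\<close> is the family at
    \<open>m + 1\<close>, which is zero by assumption.\<close>
  define z where "z k r s = x (r + 1) (s + 1) (k + 1)" for k r s
  have "det (G' N m x) =
      det (mat (N * m) (N * m) (\<lambda>(i, j). G' N m x $$ (regroup N m i, regroup N m j)))"
    by (rule det_permute_rows_cols[OF _ regroup_permutes, symmetric])
      (simp add: G'_def block_matrix_def)
  also have "mat (N * m) (N * m) (\<lambda>(i, j). G' N m x $$ (regroup N m i, regroup N m j)) =
      mat (m * N) (m * N) (\<lambda>(i, j). z (max (i div N) (j div N)) (i mod N) (j mod N))"
  proof (rule eq_matI)
    fix i j
    assume "i < dim_row (mat (m * N) (m * N) (\<lambda>(i, j). z (max (i div N) (j div N)) (i mod N) (j mod N)))"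
      and "j < dim_col (mat (m * N) (m * N) (\<lambda>(i, j). z (max (i div N) (j div N)) (i mod N) (j mod N)))"
    then have ij: "i < N * m" "j < N * m" by (simp_all add: mult.commute)
    then have "i div N < m" "j div N < m"
      by (simp_all add: less_mult_imp_div_less mult.commute)
    from G'_block_flip[OF this, of x "i mod N" "j mod N"] ij
    show "mat (N * m) (N * m) (\<lambda>(i, j). G' N m x $$ (regroup N m i, regroup N m j)) $$ (i, j) =
      mat (m * N) (m * N) (\<lambda>(i, j). z (max (i div N) (j div N)) (i mod N) (j mod N)) $$ (i, j)"
      by (simp add: G'_def block_matrix_def regroup_less regroup_div_mod z_def mult.commute[of m])
  qed (simp_all add: mult.commute)
  also have "det \<dots> = (\<Prod>k<m. det (mat N N (\<lambda>(r, s). z k r s - z (Suc k) r s)))"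
    using assms by (intro det_max_block_matrix) (auto simp: z_def)
  also have "\<dots> = (\<Prod>k<m. det (X_diff N x (Suc k)))"
    by (simp add: X_diff_def mat1_def z_def)
  also have "\<dots> = (\<Prod>i = 1..m. det (X_diff N x i))"
    by (simp add: prod.atLeast1_atMost_eq)
  finally show ?thesis .
qed

end
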